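(* Let $n>1$ be a positive odd integer. Then \[ \sum_{k=0}^{(n-1)/2}[4k+1]\frac{(q^{-1};q^2)_k\, (q;q^2)_k^3} {(q^4;q^2)_k\, (q^2;q^2)_k^3}\, q^{2k} \equiv 0 \pmod{[n]^3}. \]
   Context: Here $q$ is an indeterminate. For $x$ and a base $p$ (a power of $q$), $(x;p)_k=\prod_{j=0}^{k-1}(1-xp^j)$ for integers $k\ge0$. The $q$-integer is $[j]=1+q+\cdots+q^{j-1}$. For rational functions $A(q),B(q)$ and a polynomial $P(q)$, $A\equiv B\pmod{P}$ means that the numerator of the reduced form of $A-B$ is divisible by $P$ in $\mathbb{Z}[q]$. *)

theory Defs
  imports "HOL-Computational_Algebra.Computational_Algebra"
begin

text \<open>
  Rational functions in \<open>q\<close> are elements of the fraction field of \<open>int poly\<close>, that is,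
  of \<open>\<rat>(q) = Frac(\<int>[q])\<close>.
\<close>

type_synonym ratfun = "int poly fract"

abbreviation qX :: "int poly" where
  "qX \<equiv> [:0, 1:]"

abbreviation qF :: ratfun where
  "qF \<equiv> to_fract qX"

definition qpoch :: "'a::comm_ring_1 \<Rightarrow> 'a \<Rightarrow> nat \<Rightarrow> 'a" where
  "qpoch x p k = (\<Prod>j<k. 1 - x * p ^ j)"

text \<open>The argument \<open>x\<close> is the variable \<open>q\<close>, taken in \<open>\<int>[q]\<close> or in \<open>\<rat>(q)\<close>.\<close>

definition qint :: "'a::comm_ring_1 \<Rightarrow> nat \<Rightarrow> 'a" where
  "qint x m = (\<Sum>i<m. x ^ i)"

text \<open>
  \<open>quot_of_fract\<close> gives the numerator and denominator of the reduced form of a fraction: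
  they are coprime in \<open>\<int>[q]\<close>, hence share no integer content either, and the
  denominator has positive leading coefficient.
\<close>

definition ratfun_cong :: "ratfun \<Rightarrow> ratfun \<Rightarrow> int poly \<Rightarrow> bool" where
  "ratfun_cong A B P \<longleftrightarrow> P dvd fst (quot_of_fract (A - B))"

end

theory Submission
  imports Defs
begin

text \<open>
  With base \<open>q\<^sup>2\<close>, \<open>a = c = d = q\<close> and \<open>b = q\<^sup>-\<^sup>1\<close> the sum is a partial sum of a very well-poised
  \<open>\<^sub>6\<phi>\<^sub>5\<close> series with \<open>a = b c d\<close>, so it telescopes. For \<open>n = 2 m + 1\<close> its value is
  \<open>[n]\<^sup>3 (q;q\<^sup>2)\<^sub>m\<^sup>4 / ((q\<^sup>2;q\<^sup>2)\<^sub>m\<^sup>3 (q\<^sup>4;q\<^sup>2)\<^sub>m)\<close>. This denominator may share factors with \<open>[n]\<close> when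
  \<open>n\<close> is composite; they disappear on writing \<open>(q;q\<^sup>2)\<^sub>m / (q\<^sup>2;q\<^sup>2)\<^sub>m = B / (-q;q)\<^sub>m\<^sup>2\<close> with the
  Gaussian binomial \<open>B\<close> of \<open>2 m\<close> over \<open>m\<close>, which gives
  \<open>[n]\<^sup>3 B\<^sup>4 (1 + q) / ((-q;q)\<^sub>m\<^sup>8 [n + 1])\<close>, whose denominator is coprime to \<open>[n]\<close>.
\<close>

section \<open>q-shifted factorials and the telescoping sum\<close>

lemma qpoch_0 [simp]: "qpoch x p 0 = 1"
  by (simp add: qpoch_def)

lemma qpoch_Suc: "qpoch x p (Suc m) = qpoch x p m * (1 - x * p ^ m)"
  by (simp add: qpoch_def)

text \<open>Both sides are the product of length \<open>m + 1\<close>, once with its first and once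
  with its last factor split off.\<close>

lemma qpoch_shift: "(1 - x) * qpoch (x * p) p m = qpoch x p m * (1 - x * p ^ m)"
proof (induction m)
  case (Suc m)
  have "(1 - x) * qpoch (x * p) p (Suc m) = ((1 - x) * qpoch (x * p) p m) * (1 - x * p ^ Suc m)"
    by (simp add: qpoch_Suc mult.assoc)
  then show ?case
    by (simp only: Suc qpoch_Suc)
qed simp

lemma qint_mult: "(1 - x) * qint x n = 1 - x ^ n"
  by (simp add: qint_def one_diff_power_eq)

lemma one_minus_dvd_one_minus_power: "1 - x dvd 1 - (x :: 'a::comm_ring_1) ^ n"
  by (metis qint_mult dvd_triv_left)

lemma qpoch_even_odd: "qpoch x x (2 * m) = qpoch x (x ^ 2) m * qpoch (x ^ 2) (x ^ 2) m"
  by (induction m) (simp_all add: qpoch_Suc mult_ac power2_eq_square power_mult power_mult_distrib)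

lemma qpoch_square: "qpoch (x ^ 2) (x ^ 2) m = qpoch x x m * qpoch (- x) x m"
proof (induction m)
  case (Suc m)
  have "1 - x ^ 2 * (x ^ 2) ^ m = (1 - x * x ^ m) * (1 - (- x) * x ^ m)"
    by (simp add: algebra_simps power2_eq_square power_mult_distrib)
  then show ?case
    by (simp add: qpoch_Suc Suc mult_ac)
qed simp

text \<open>The step splits \<open>1 - x\<^bsup>i+j\<^esup> = (1 - x\<^sup>i) + x\<^sup>i (1 - x\<^sup>j)\<close>, the \<open>q\<close>-Pascal rule.\<close>

lemma qpoch_mult_dvd: "qpoch x x i * qpoch x x j dvd qpoch x x (i + j)"
proof (induction "i + j" arbitrary: i j)
  case (Suc s)
  show ?case
  proof (cases "i = 0 \<or> j = 0")
    case False
    then obtain i' j' where ij: "i = Suc i'" "j = Suc j'"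
      by (metis not0_implies_Suc)
    let ?r = "qpoch x x (i' + Suc j')"
    have split: "qpoch x x i = qpoch x x i' * (1 - x ^ i)" "qpoch x x j = qpoch x x j' * (1 - x ^ j)"
      using ij by (simp_all add: qpoch_Suc)
    have dvd: "qpoch x x i' * qpoch x x j dvd ?r" "qpoch x x i * qpoch x x j' dvd ?r"
      using Suc.hyps(1)[of i' j] Suc.hyps(1)[of i j'] Suc.hyps(2) ij by auto
    have "qpoch x x i * qpoch x x j dvd ?r * (1 - x ^ i)"
      using mult_dvd_mono[OF dvd(1) dvd_refl[of "1 - x ^ i"]] by (simp add: split(1) mult_ac)
    moreover have "qpoch x x i * qpoch x x j dvd ?r * (1 - x ^ j)"
      using mult_dvd_mono[OF dvd(2) dvd_refl[of "1 - x ^ j"]] by (simp add: split(2) mult_ac)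
    ultimately have "qpoch x x i * qpoch x x j dvd ?r * (1 - x ^ i) + x ^ i * (?r * (1 - x ^ j))"
      by (metis dvd_add dvd_mult)
    also have "\<dots> = qpoch x x (i + j)"
      using ij by (simp add: qpoch_Suc algebra_simps power_add)
    finally show ?thesis .
  qed auto
qed simp

text \<open>Induction on \<open>m\<close>. The lower parameters \<open>a p / b\<close>,
  \<open>a p / c\<close>, \<open>a p / d\<close> of the well-poised series become
  \<open>c d p\<close>, \<open>b d p\<close>, \<open>b c p\<close> through \<open>a = b c d\<close>.
  The usual divisor \<open>1 - a\<close> stands on the right as a factor.\<close>

lemma sum_very_well_poised:
  fixes a b c d p :: "'a::field"
  assumes a: "a = b * c * d"
    and nz: "\<And>k. qpoch p p k \<noteq> 0" "\<And>k. qpoch (c * d * p) p k \<noteq> 0"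
      "\<And>k. qpoch (b * d * p) p k \<noteq> 0" "\<And>k. qpoch (b * c * p) p k \<noteq> 0"
  shows "(\<Sum>k\<le>m. (1 - a * p ^ (2 * k)) *
      ((qpoch a p k * qpoch b p k * qpoch c p k * qpoch d p k) /
       (qpoch p p k * qpoch (c * d * p) p k * qpoch (b * d * p) p k * qpoch (b * c * p) p k)) * p ^ k)
    = (1 - a) * ((qpoch (a * p) p m * qpoch (b * p) p m * qpoch (c * p) p m * qpoch (d * p) p m) /
       (qpoch p p m * qpoch (c * d * p) p m * qpoch (b * d * p) p m * qpoch (b * c * p) p m))"
proof (induction m)
  case 0
  then show ?case by simp
next
  case (Suc m)
  define y where "y = p ^ Suc m"
  define N where "N = qpoch (a * p) p m * qpoch (b * p) p m * qpoch (c * p) p m * qpoch (d * p) p m"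
  define D where
    "D k = qpoch p p k * qpoch (c * d * p) p k * qpoch (b * d * p) p k * qpoch (b * c * p) p k" for k
  define r where "r = (1 - y) * (1 - c * d * y) * (1 - b * d * y) * (1 - b * c * y)"
  have y: "p * p ^ m = y" "z * p * p ^ m = z * y" for z
    by (simp_all add: y_def)
  have D0: "D k \<noteq> 0" for k
    using nz by (simp add: D_def)
  have D: "D (Suc m) = D m * r"
    by (simp add: D_def r_def qpoch_Suc y mult_ac)
  have r0: "r \<noteq> 0"
    using D D0 by (metis mult_zero_right)
  \<comment> \<open>Taking out the first factor rather than the last expresses the new term through
    the shifted products in \<open>N\<close>.\<close>
  have first: "qpoch z p (Suc m) = (1 - z) * qpoch (z * p) p m" for z
    by (simp add: qpoch_shift qpoch_Suc)
  have num: "qpoch a p (Suc m) * qpoch b p (Suc m) * qpoch c p (Suc m) * qpoch d p (Suc m)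
      = (1 - a) * (1 - b) * (1 - c) * (1 - d) * N"
    unfolding first N_def by (simp add: mult_ac)
  have num': "qpoch (a * p) p (Suc m) * qpoch (b * p) p (Suc m) * qpoch (c * p) p (Suc m)
        * qpoch (d * p) p (Suc m)
      = (1 - a * y) * (1 - b * y) * (1 - c * y) * (1 - d * y) * N"
    by (simp add: qpoch_Suc N_def y mult_ac)
  have py: "p ^ (2 * Suc m) = y ^ 2"
    by (simp only: y_def power_mult[symmetric] mult.commute)
  \<comment> \<open>Once the common factors are cleared, the induction step is this polynomial
    identity, which rests on \<open>a = b c d\<close>.\<close>
  have key: "r + (1 - a * y ^ 2) * ((1 - b) * (1 - c) * (1 - d)) * y
      = (1 - a * y) * (1 - b * y) * (1 - c * y) * (1 - d * y)"
    unfolding r_def a by algebra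
  have "(1 - a) * (N / D m)
      + (1 - a * y ^ 2) * ((1 - a) * (1 - b) * (1 - c) * (1 - d) * N / D (Suc m)) * y
    = (1 - a) * (N * (r + (1 - a * y ^ 2) * ((1 - b) * (1 - c) * (1 - d)) * y) / D (Suc m))"
    unfolding D using r0 D0[of m] by (simp add: field_simps)
  also have "\<dots> = (1 - a) * ((1 - a * y) * (1 - b * y) * (1 - c * y) * (1 - d * y) * N / D (Suc m))"
    by (simp only: key mult.commute[of N])
  finally show ?case
    using Suc.IH
    unfolding sum.atMost_Suc num num' py D_def[symmetric] N_def[symmetric] y_def[symmetric]
    by simp
qed

section \<open>Passing between polynomials and rational functions\<close>

lemma to_fract_power: "to_fract (x ^ k) = to_fract x ^ k"
  by (induction k) simp_all

lemma to_fract_qpoch: "to_fract (qpoch x p k) = qpoch (to_fract x) (to_fract p) k"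
  by (induction k) (simp_all add: qpoch_Suc to_fract_power)

lemma to_fract_qint: "to_fract (qint x k) = qint (to_fract x) k"
  by (induction k) (simp_all add: qint_def to_fract_power)

lemma qpoch_qX_nonzero:
  assumes "i > 0"
  shows "qpoch (qX ^ i) p k \<noteq> 0"
proof -
  have "poly (qpoch (qX ^ i) p k) 0 = 1"
    using assms by (induction k) (simp_all add: qpoch_Suc zero_power)
  then show ?thesis by auto
qed

lemma qpoch_qF_nonzero:
  assumes "i > 0"
  shows "qpoch (qF ^ i) (qF ^ j) k \<noteq> 0"
  using qpoch_qX_nonzero[OF assms, of "qX ^ j" k]
  by (simp add: to_fract_power[symmetric] to_fract_qpoch[symmetric])

text \<open>The reduced form \<open>u / v\<close> of \<open>A\<close> satisfies
  \<open>u D = P N v\<close>, and coprimality moves \<open>P\<close> onto \<open>u\<close>. Hence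
  the representation \<open>P N / D\<close> may be unreduced.\<close>

lemma ratfun_cong_0I:
  assumes "A * to_fract D = to_fract (P * N)" and "coprime P D" and "D \<noteq> 0"
  shows "ratfun_cong A 0 P"
proof -
  obtain u v where uv: "quot_of_fract A = (u, v)" by fastforce
  have v: "v \<noteq> 0" using snd_quot_of_fract_nonzero[of A] uv by simp
  have "A = to_fract u / to_fract v"
    using uv by (metis Fract_conv_to_fract Fract_quot_of_fract fst_conv snd_conv)
  then have u: "to_fract u = A * to_fract v"
    using v by simp
  have "to_fract (u * D) = (A * to_fract D) * to_fract v"
    by (simp add: u mult_ac)
  then have "to_fract (u * D) = to_fract (P * N * v)"
    by (simp add: assms(1))
  then have "u * D = P * (N * v)"
    by (simp only: to_fract_eq_iff mult.assoc)
  then have "P dvd u * D" by simp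
  then have "P dvd u"
    using assms(2) by (simp add: coprime_dvd_mult_left_iff)
  then show ?thesis
    by (simp add: ratfun_cong_def uv)
qed

section \<open>Factors coprime to \<open>[n]\<close>\<close>

lemma coprime_qint_qint_Suc: "coprime (qint x n) (qint x (Suc n))"
proof -
  have "qint x (Suc n) = 1 + x * qint x n"
    by (simp add: qint_def sum.lessThan_Suc_shift sum_distrib_left del: sum.lessThan_Suc)
  then have "c dvd 1" if "c dvd qint x n" "c dvd qint x (Suc n)" for c
    using that by (metis dvd_add_left_iff dvd_mult)
  then show ?thesis
    by (rule coprimeI)
qed

text \<open>Modulo a common divisor, \<open>1 = x\<^bsup>jn\<^esup> = (-1)\<^sup>n = -1\<close>.\<close>

lemma common_divisor_qint_one_plus_power:
  fixes x :: "'a::comm_ring_1"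
  assumes "odd n" "d dvd qint x n" "d dvd 1 + x ^ j"
  shows "d dvd 2"
proof -
  have "d dvd 1 - x ^ n"
    using assms(2) by (metis qint_mult dvd_mult)
  then have 1: "d dvd 1 - x ^ (n * j)"
    unfolding power_mult using one_minus_dvd_one_minus_power dvd_trans by blast
  have "1 - (- (x ^ j)) dvd 1 - (- (x ^ j)) ^ n"
    by (rule one_minus_dvd_one_minus_power)
  then have "1 + x ^ j dvd 1 + x ^ (n * j)"
    using assms(1) by (simp add: power_mult[symmetric] mult.commute)
  then have "d dvd 1 + x ^ (n * j)"
    using assms(3) dvd_trans by blast
  with 1 have "d dvd (1 - x ^ (n * j)) + (1 + x ^ (n * j))"
    by (rule dvd_add)
  then show ?thesis by simp
qed

lemma coeff_0_qint: "n > 0 \<Longrightarrow> coeff (qint qX n) 0 = 1"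
  by (cases n) (simp_all add: qint_def coeff_sum coeff_0_power sum.lessThan_Suc_shift del: sum.lessThan_Suc)

text \<open>A common divisor divides 2, so it is a constant; as the constant term of
  \<open>[n]\<close> is 1, this constant is a unit.\<close>

lemma coprime_qint_one_plus_power:
  assumes "odd n"
  shows "coprime (qint qX n) (1 + qX ^ j)"
proof (rule coprimeI)
  fix d assume d: "d dvd qint qX n" "d dvd 1 + qX ^ j"
  obtain e where e: "2 = d * e"
    using common_divisor_qint_one_plus_power[OF assms d] by blast
  then have "d \<noteq> 0" "e \<noteq> 0" by auto
  then have "degree d + degree e = degree (2 :: int poly)"
    unfolding e by (rule degree_mult_eq[symmetric])
  then have "degree d = 0" by simp
  then obtain c where c: "d = [:c:]"
    by (rule degree_eq_zeroE)
  then have "c dvd coeff (qint qX n) 0"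
    using d(1) const_poly_dvd_iff by blast
  then have "c dvd 1"
    using coeff_0_qint[OF odd_pos[OF assms]] by simp
  then show "is_unit d"
    using c by (simp add: is_unit_const_poly_iff)
qed

lemma coprime_qint_qpoch:
  assumes "odd n"
  shows "coprime (qint qX n) (qpoch (- qX) qX m)"
proof (induction m)
  case (Suc m)
  have "1 - (- qX) * qX ^ m = 1 + qX ^ Suc m"
    by simp
  then show ?case
    using Suc coprime_qint_one_plus_power[OF assms, of "Suc m"] by (simp only: qpoch_Suc coprime_mult_right_iff)
qed simp

theorem theorem5p9:
  fixes n :: nat
  assumes "n > 1" and "odd n"
  shows "ratfun_cong
    (\<Sum>k = 0..(n - 1) div 2.
       qint qF (4 * k + 1) *
       (qpoch (inverse qF) (qF ^ 2) k * qpoch qF (qF ^ 2) k ^ 3 /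
        (qpoch (qF ^ 4) (qF ^ 2) k * qpoch (qF ^ 2) (qF ^ 2) k ^ 3)) *
       qF ^ (2 * k))
    0 (qint qX n ^ 3)"
    (is "ratfun_cong ?S 0 _")
proof -
  define m where "m = (n - 1) div 2"
  have n: "n = 2 * m + 1" using assms by (simp add: m_def)
  have q1: "1 - qF \<noteq> 0" and q0: "qF \<noteq> 0"
    using qpoch_qF_nonzero[of 1 1 1] by (simp_all add: qpoch_def)
  define u v w V P R where
    "u = qpoch qF (qF ^ 2) m" and "v = qpoch (qF ^ 2) (qF ^ 2) m" and
    "w = qpoch (- qF) qF m" and "V = qpoch (qF ^ 4) (qF ^ 2) m" and
    "P = qint qF n" and "R = qint qF (Suc n)"
  note defs = this
  have v0: "v \<noteq> 0" and V0: "V \<noteq> 0" and x0: "qpoch qF qF m \<noteq> 0"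
    using qpoch_qF_nonzero[of 1 1 m] by (simp_all add: v_def V_def qpoch_qF_nonzero)
  \<comment> \<open>\<open>B\<close> is the Gaussian binomial of \<open>2 m\<close> over
    \<open>m\<close>, obtained inside the polynomial ring so that it brings no denominator.\<close>
  obtain B where B: "qpoch qX qX (m + m) = qpoch qX qX m * qpoch qX qX m * B"
    using qpoch_mult_dvd[of qX m m] by (elim dvdE)
  have "u * v = qpoch qF qF m * qpoch qF qF m * to_fract B"
    using arg_cong[OF B, of to_fract] qpoch_even_odd[of qF m]
    by (simp add: u_def v_def to_fract_qpoch mult_2)
  moreover have vw: "v = qpoch qF qF m * w"
    unfolding v_def w_def by (rule qpoch_square)
  have "qpoch qF qF m * qpoch qF qF m * (u * w ^ 2) = u * v * v"
    by (simp add: vw power2_eq_square mult_ac)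
  ultimately have "qpoch qF qF m * qpoch qF qF m * (u * w ^ 2) = qpoch qF qF m * qpoch qF qF m * (to_fract B * v)"
    by (simp add: mult_ac)
  then have Bv: "u * w ^ 2 = to_fract B * v"
    using x0 by simp
  have pow: "qF * qF ^ 2 = qF ^ 3" "qF ^ 2 * qF ^ 2 = qF ^ 4" "qF * (qF ^ 2) ^ m = qF ^ n"
    "qF ^ 2 * (qF ^ 2) ^ m = qF ^ Suc n"
    by (simp_all add: n power_mult_distrib power_add eval_nat_numeral)
  \<comment> \<open>Source of the cube: \<open>a p = c p = d p = q^3\<close>, and each such product
    yields one factor \<open>[n]\<close>.\<close>
  have "(1 - qF) * qpoch (qF ^ 3) (qF ^ 2) m = (1 - qF) * (P * u)"
    using qpoch_shift[of qF "qF ^ 2" m] qint_mult[of qF n] unfolding pow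
    by (simp add: P_def u_def mult_ac)
  then have u3: "qpoch (qF ^ 3) (qF ^ 2) m = P * u"
    using q1 by simp
  have "(1 - qF) * ((1 + qF) * V) = (1 - qF ^ 2) * V"
    by (simp add: algebra_simps power2_eq_square)
  also have "\<dots> = (1 - qF) * (v * R)"
    using qpoch_shift[of "qF ^ 2" "qF ^ 2" m] qint_mult[of qF "Suc n"] unfolding pow
    by (simp add: V_def v_def R_def mult_ac)
  finally have VR: "(1 + qF) * V = v * R"
    using q1 by simp
  have args: "qF * qF * qF ^ 2 = qF ^ 4" "inverse qF * qF * qF ^ 2 = qF ^ 2" "inverse qF * qF ^ 2 = qF"
    using q0 by (simp_all add: eval_nat_numeral)
  \<comment> \<open>The factor \<open>1 - q\<close> turns \<open>[4 k + 1]\<close> into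
    \<open>1 - a p^(2 k)\<close> with \<open>a = q\<close> and \<open>p = q^2\<close>.\<close>
  have "(1 - qF) * ?S = (\<Sum>k\<le>m. (1 - qF * (qF ^ 2) ^ (2 * k)) *
      ((qpoch qF (qF ^ 2) k * qpoch (inverse qF) (qF ^ 2) k * qpoch qF (qF ^ 2) k * qpoch qF (qF ^ 2) k) /
       (qpoch (qF ^ 2) (qF ^ 2) k * qpoch (qF * qF * qF ^ 2) (qF ^ 2) k
        * qpoch (inverse qF * qF * qF ^ 2) (qF ^ 2) k
        * qpoch (inverse qF * qF * qF ^ 2) (qF ^ 2) k)) * (qF ^ 2) ^ k)"
    unfolding sum_distrib_left m_def[symmetric] atLeast0AtMost
  proof (rule sum.cong[OF refl], goal_cases)
    case (1 k)
    show ?case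
      unfolding args power_mult[symmetric] by (simp add: qint_mult power3_eq_cube mult_ac)
  qed
  also have "\<dots> = (1 - qF) * ((P * u) ^ 3 * u / (v ^ 3 * V))"
    using q0 sum_very_well_poised[of qF "inverse qF" qF qF "qF ^ 2" m]
    unfolding args pow(1) u3
    by (simp add: qpoch_qF_nonzero u_def[symmetric] v_def[symmetric] V_def[symmetric]
        power3_eq_cube mult_ac)
  finally have S: "?S = (P * u) ^ 3 * u / (v ^ 3 * V)"
    by (simp only: mult_left_cancel[OF q1])
  \<comment> \<open>The power \<open>w^8\<close> pairs with \<open>u^4\<close> to give
    \<open>(u w^2)^4 = B^4 v^4\<close>, which cancels \<open>v^3\<close>; \<open>R\<close> pairs
    with the remaining \<open>v\<close> to cancel \<open>V\<close>.\<close>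
  have "?S * (w ^ 8 * R) = P ^ 3 * (u * w ^ 2) ^ 4 * R / (v ^ 3 * V)"
    unfolding S by (simp add: power_mult_distrib power_mult[symmetric] eval_nat_numeral mult_ac)
  also have "\<dots> = P ^ 3 * to_fract B ^ 4 * (v * R) / V"
    unfolding Bv using v0 by (simp add: power_mult_distrib eval_nat_numeral)
  also have "\<dots> = P ^ 3 * (to_fract B ^ 4 * (1 + qF))"
    unfolding VR[symmetric] using V0 by simp
  finally have "?S * to_fract (qpoch (- qX) qX m ^ 8 * qint qX (Suc n))
      = to_fract (qint qX n ^ 3 * (B ^ 4 * (1 + qX)))"
    by (simp only: defs to_fract_mult to_fract_add to_fract_1 to_fract_uminus to_fract_power
        to_fract_qpoch to_fract_qint)
  moreover have "coprime (qint qX n ^ 3) (qpoch (- qX) qX m ^ 8 * qint qX (Suc n))"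
    using coprime_qint_qint_Suc[of qX n] coprime_qint_qpoch[OF assms(2), of m] by simp
  moreover have "qpoch (- qX) qX m ^ 8 * qint qX (Suc n) \<noteq> 0"
  proof -
    \<comment> \<open>Evaluation at \<open>q = 0\<close> gives 1 for both factors.\<close>
    have "poly (qpoch (- qX) qX m) 0 = 1"
      by (induction m) (simp_all add: qpoch_Suc)
    moreover have "poly (qint qX (Suc n)) 0 = 1"
      using coeff_0_qint[of "Suc n"] by (simp add: poly_0_coeff_0)
    ultimately show ?thesis by auto
  qed
  ultimately show ?thesis
    by (rule ratfun_cong_0I)
qed

end
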